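(* Let $\mathcal{C}$ be an $[n,k]_q$ MWS code. If $a,b\in\mathcal{C}\setminus\{0\}$ satisfy $V(a)=V(b)$, then $a=\lambda b$ for some $\lambda\in\mathbb{F}_q^*$.
   Context: $\alpha$ is a fixed primitive element of $\mathbb{F}_q$. An $[n,k]_q$ code is a $k$-dimensional subspace of $\mathbb{F}_q^n$ (non-degenerate if $k\ge 2$) with Hamming weight $w$; it is MWS if $|\{w(c):c\in\mathcal{C}\setminus\{0\}\}|=\frac{q^k-1}{q-1}$. For $c\in\mathbb{F}_q^n$, $\beta\in\mathbb{F}_q$, $c[\beta]=|\{l:c_l=\beta\}|$ and $V(c)=(c[\alpha],\dots,c[\alpha^{q-1}],c[0])$. *)

theory Defs
  imports "HOL-Analysis.Analysis"
begin

text \<open>Vectors of F_q^n are modelled as elements of the type 'a ^ 'n, where 'a is a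
finite field (q = CARD('a)) and the finite index type 'n has n = CARD('n) elements.
Scalar multiplication is the library operation (*s).\<close>

definition hamming_weight :: "'a::zero ^ 'n \<Rightarrow> nat" where
  "hamming_weight c = card {l. c $ l \<noteq> 0}"

text \<open>c[beta] = number of coordinates of c equal to beta\<close>
definition coord_count :: "'a ^ 'n \<Rightarrow> 'a \<Rightarrow> nat" where
  "coord_count c \<beta> = card {l. c $ l = \<beta>}"

text \<open>alpha is a primitive element of the finite field (generator of the multiplicative group)\<close>
definition primitive_elem :: "'a::field \<Rightarrow> bool" where
  "primitive_elem \<alpha> \<longleftrightarrow> \<alpha> \<noteq> 0 \<and> (\<forall>x. x \<noteq> 0 \<longrightarrow> (\<exists>i::nat. x = \<alpha> ^ i))"

text \<open>V(c) = (c[alpha], ..., c[alpha^(q-1)], c[0])\<close>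
definition Vvec :: "'a::{finite,field} \<Rightarrow> 'a ^ 'n \<Rightarrow> nat list" where
  "Vvec \<alpha> c = map (\<lambda>i. coord_count c (\<alpha> ^ i)) [1..<CARD('a)] @ [coord_count c 0]"

text \<open>An [n,k]_q linear code: a k-dimensional subspace of F_q^n;
  as a standing convention it is non-degenerate (no coordinate identically zero) if k >= 2.\<close>
definition nondegenerate :: "('a::zero ^ 'n) set \<Rightarrow> bool" where
  "nondegenerate C \<longleftrightarrow> (\<forall>l. \<exists>c\<in>C. c $ l \<noteq> 0)"

definition linear_code :: "('a::{finite,field} ^ 'n) set \<Rightarrow> nat \<Rightarrow> bool" where
  "linear_code C k \<longleftrightarrow>
     module.subspace ((*s) :: 'a \<Rightarrow> 'a ^ 'n \<Rightarrow> 'a ^ 'n) C \<and>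
     vector_space.dim ((*s) :: 'a \<Rightarrow> 'a ^ 'n \<Rightarrow> 'a ^ 'n) C = k \<and>
     (k \<ge> 2 \<longrightarrow> nondegenerate C)"

text \<open>MWS (maximum weight spectrum): the number of distinct nonzero weights is (q^k-1)/(q-1).\<close>
definition MWS :: "('a::{finite,field} ^ 'n) set \<Rightarrow> nat \<Rightarrow> bool" where
  "MWS C k \<longleftrightarrow> linear_code C k \<and>
     card (hamming_weight ` (C - {0})) = (CARD('a) ^ k - 1) div (CARD('a) - 1)"

end

theory Submission
  imports Defs
begin

(* The nonzero codewords fall into (q^k - 1)/(q - 1) projective points (classes of nonzero
   scalar multiples), and the Hamming weight is constant on each of them. An MWS code has
   exactly that many distinct nonzero weights, so the weight separates projective points.
   The last entry of V(c) counts the zero coordinates of c, so V(a) = V(b) already forces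
   equal weights. *)

context vector_space
begin

lemma card_span_independent:
  assumes "finite (UNIV :: 'a set)" "finite B" "independent B"
  shows "card (span B) = CARD('a) ^ card B"
  using assms(2,3)
proof (induction B rule: finite_induct)
  case empty
  then show ?case by simp
next
  case (insert x B)
  have x_notin: "x \<notin> span B" and indep_B: "independent B"
    using insert.prems insert.hyps independent_mono by (auto simp: independent_insert)
  let ?f = "\<lambda>(c, y). scale c x + y"
  have span_eq: "span (insert x B) = ?f ` (UNIV \<times> span B)"
  proof safe
    fix z assume "z \<in> span (insert x B)"
    then obtain c where "z - scale c x \<in> span B" unfolding span_insert by auto
    then show "z \<in> ?f ` (UNIV \<times> span B)"
      by (intro image_eqI[of _ _ "(c, z - scale c x)"]) auto
  next
    fix c y assume "y \<in> span B"
    then show "scale c x + y \<in> span (insert x B)"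
      by (meson insertI1 span_add span_base span_mono span_scale subsetD subset_insertI)
  qed
  have "inj_on ?f (UNIV \<times> span B)"
  proof (rule inj_onI, clarify)
    fix c y d z
    assume y: "y \<in> span B" and z: "z \<in> span B" and eq: "scale c x + y = scale d x + z"
    have "c = d"
    proof (rule ccontr)
      assume "c \<noteq> d"
      have "x = scale (inverse (c - d)) (scale (c - d) x)"
        using \<open>c \<noteq> d\<close> by simp
      also have "scale (c - d) x = z - y"
        using eq by (simp add: algebra_simps)
      finally have "x \<in> span B"
        using y z by (simp add: span_diff span_scale)
      with x_notin show False by contradiction
    qed
    then show "c = d \<and> y = z" using eq by simp
  qed
  then have "card (span (insert x B)) = card ((UNIV :: 'a set) \<times> span B)"
    unfolding span_eq by (rule card_image)
  also have "\<dots> = CARD('a) * CARD('a) ^ card B"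
    using insert.IH[OF indep_B] by (simp add: card_cartesian_product)
  finally show ?case using insert.hyps by simp
qed

end

lemma card_subspace:
  fixes C :: "('a::{finite,field} ^ 'n) set"
  assumes "vec.subspace C"
  shows "card C = CARD('a) ^ vec.dim C"
proof -
  obtain B where B: "B \<subseteq> C" "vec.independent B" "C \<subseteq> vec.span B" "card B = vec.dim C"
    by (rule vec.basis_exists)
  then have "vec.span B = C" using assms by (simp add: vec.span_subspace)
  with B show ?thesis by (metis finite vec.card_span_independent)
qed

definition proj_point :: "'a::field ^ 'n \<Rightarrow> ('a ^ 'n) set" where
  "proj_point x = (\<lambda>c. c *s x) ` (UNIV - {0})"

lemma proj_point_self: "x \<in> proj_point x"
  unfolding proj_point_def by (rule image_eqI[of _ _ 1]) auto

lemma proj_point_eq_if_mem: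
  fixes x y :: "'a::field ^ 'n"
  assumes "y \<in> proj_point x"
  shows "proj_point y = proj_point x"
proof -
  obtain c where c: "c \<noteq> 0" "y = c *s x" using assms unfolding proj_point_def by auto
  show ?thesis
  proof
    show "proj_point y \<subseteq> proj_point x"
      unfolding proj_point_def c using c(1) by (auto simp: vector_smult_assoc)
    have "d *s x = (d * inverse c) *s y" for d using c by (simp add: vector_smult_assoc)
    then show "proj_point x \<subseteq> proj_point y"
      unfolding proj_point_def using c(1) by (auto intro!: image_eqI)
  qed
qed

lemma proj_point_eq_iff:
  fixes x y :: "'a::field ^ 'n"
  shows "proj_point x = proj_point y \<longleftrightarrow> (\<exists>c. c \<noteq> 0 \<and> x = c *s y)"
proof
  assume "proj_point x = proj_point y"
  then have "x \<in> proj_point y" using proj_point_self by metis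
  then show "\<exists>c. c \<noteq> 0 \<and> x = c *s y" unfolding proj_point_def by auto
next
  assume "\<exists>c. c \<noteq> 0 \<and> x = c *s y"
  then show "proj_point x = proj_point y"
    by (intro proj_point_eq_if_mem) (auto simp: proj_point_def)
qed

lemma card_proj_point:
  fixes x :: "'a::{finite,field} ^ 'n"
  assumes "x \<noteq> 0"
  shows "card (proj_point x) = CARD('a) - 1"
proof -
  have "inj_on (\<lambda>c. c *s x) (UNIV - {0})"
    using assms by (auto intro: inj_onI)
  then have "card (proj_point x) = card (UNIV - {0::'a})"
    unfolding proj_point_def by (rule card_image)
  then show ?thesis by (simp add: card_Diff_subset)
qed

lemma card_proj_points_subspace:
  fixes C :: "('a::{finite,field} ^ 'n) set"
  assumes "vec.subspace C"
  shows "card (proj_point ` (C - {0})) = (CARD('a) ^ vec.dim C - 1) div (CARD('a) - 1)"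
proof -
  let ?P = "proj_point ` (C - {0})"
  have "\<Union>?P = C - {0}"
    using assms proj_point_self by (auto simp: proj_point_def vec.subspace_scale)
  moreover have "(CARD('a) - 1) * card ?P = card (\<Union>?P)"
  proof (rule card_partition)
    show "card p = CARD('a) - 1" if "p \<in> ?P" for p
      using that card_proj_point by auto
    show "p \<inter> p' = {}" if "p \<in> ?P" "p' \<in> ?P" "p \<noteq> p'" for p p'
    proof -
      have "proj_point z = p \<and> proj_point z = p'" if "z \<in> p" "z \<in> p'" for z
        using that \<open>p \<in> ?P\<close> \<open>p' \<in> ?P\<close> proj_point_eq_if_mem by blast
      then show ?thesis using \<open>p \<noteq> p'\<close> by blast
    qed
  qed auto
  moreover have "card (C - {0}) = CARD('a) ^ vec.dim C - 1"
    using card_subspace[OF assms] vec.subspace_0[OF assms] by (simp add: card_Diff_singleton)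
  moreover have "CARD('a) - 1 > 0"
    using card_mono[of UNIV "{0::'a, 1}"] by simp
  ultimately show ?thesis by (metis nonzero_mult_div_cancel_left less_not_refl2)
qed

lemma fibres_eq_if_card_image_eq:
  assumes "finite A"
    and "\<And>x y. x \<in> A \<Longrightarrow> y \<in> A \<Longrightarrow> g x = g y \<Longrightarrow> f x = f y"
    and "card (f ` A) = card (g ` A)"
    and "x \<in> A" "y \<in> A" "f x = f y"
  shows "g x = g y"
proof -
  define h where "h z = f (inv_into A g z)" for z
  have h_g: "h (g x) = f x" if "x \<in> A" for x
    unfolding h_def using that by (intro assms(2) inv_into_into f_inv_into_f) auto
  then have "f ` A = h ` g ` A" by (auto simp: image_image)
  then have "inj_on h (g ` A)"
    using assms(1,3) by (simp add: inj_on_iff_eq_card)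
  then show ?thesis
    using assms(4-6) h_g by (metis image_eqI inj_onD)
qed

lemma hamming_weight_scale:
  fixes x :: "'a::field ^ 'n"
  assumes "c \<noteq> 0"
  shows "hamming_weight (c *s x) = hamming_weight x"
  unfolding hamming_weight_def using assms by simp

lemma hamming_weight_eq_card_minus_zeros:
  fixes x :: "'a::zero ^ 'n"
  shows "hamming_weight x = CARD('n) - coord_count x 0"
proof -
  have "{l. x $ l \<noteq> 0} = UNIV - {l. x $ l = 0}" by auto
  then show ?thesis
    unfolding hamming_weight_def coord_count_def by (simp add: card_Diff_subset)
qed

lemma Vvec_eq_imp_hamming_weight_eq:
  fixes a b :: "'a::{finite,field} ^ 'n"
  assumes "Vvec \<alpha> a = Vvec \<alpha> b"
  shows "hamming_weight a = hamming_weight b"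
proof -
  have "coord_count a 0 = coord_count b 0"
    using arg_cong[OF assms, of last] unfolding Vvec_def by simp
  then show ?thesis by (simp add: hamming_weight_eq_card_minus_zeros)
qed

theorem mainTheorem6:
  fixes C :: "('a::{finite,field} ^ 'n) set" and k :: nat and \<alpha> :: 'a and a b :: "'a ^ 'n"
  assumes "primitive_elem \<alpha>"
    and "MWS C k"
    and "a \<in> C - {0}" and "b \<in> C - {0}"
    and "Vvec \<alpha> a = Vvec \<alpha> b"
  shows "\<exists>c::'a. c \<noteq> 0 \<and> a = c *s b"
proof -
  have "vec.subspace C" "vec.dim C = k"
    and "card (hamming_weight ` (C - {0})) = (CARD('a) ^ k - 1) div (CARD('a) - 1)"
    using assms(2) unfolding MWS_def linear_code_def by auto
  then have same_card: "card (hamming_weight ` (C - {0})) = card (proj_point ` (C - {0}))"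
    by (simp only: card_proj_points_subspace)
  have weight_on_points: "hamming_weight x = hamming_weight y"
    if same_point: "proj_point x = proj_point y" for x y :: "'a ^ 'n"
  proof -
    obtain c where "c \<noteq> 0" "x = c *s y" using same_point by (auto simp: proj_point_eq_iff)
    then show ?thesis by (simp add: hamming_weight_scale)
  qed
  have "proj_point a = proj_point b"
    using finite weight_on_points same_card assms(3,4) Vvec_eq_imp_hamming_weight_eq[OF assms(5)]
    by (rule fibres_eq_if_card_image_eq)
  then show ?thesis by (simp add: proj_point_eq_iff)
qed

end
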